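(* For every integer $n\ge0$, $$\Delta(H_{(\dot0^n)})=\sum_{k=0}^n\tilde C(n,k)\,H_{(\dot0^{n-k})}\otimes H_{(\dot0^k)},$$ where $H_{(\dot0^m)}=\tilde H_0^{\,m}$ and $H_{(\dot0^0)}=1$.
   Context: $\mathbf{sNSym}$ is the free associative unital $\mathbb Q$-algebra on generators $H_n$ ($n\ge1$) and $\tilde H_n$ ($n\ge0$), with $H_0=1$. It is graded by fermionic degree $\mathrm{df}$, with $\mathrm{df}(H_n)=0$, $\mathrm{df}(\tilde H_n)=1$. The space $\mathbf{sNSym}\otimes\mathbf{sNSym}$ is an algebra via $(f_1\otimes g_1)(f_2\otimes g_2)=(-1)^{\mathrm{df}(g_1)\mathrm{df}(f_2)}f_1f_2\otimes g_1g_2$ for $\mathrm{df}$-homogeneous elements. The coproduct $\Delta$ is the algebra morphism with $\Delta(H_n)=\sum_{k=0}^nH_k\otimes H_{n-k}$ and $\Delta(\tilde H_n)=\sum_{k=0}^n(\tilde H_k\otimes H_{n-k}+H_{n-k}\otimes\tilde H_k)$. For $0\le k\le n$ the numbers $\tilde C(n,k)$ are defined recursively by: $\tilde C(n,k)=1$ if $k=0$ or $k=n$; otherwise $\tilde C(n,k)=0$ if $n$ is even and $k$ is odd; otherwise $\tilde C(n,k)=\tilde C(n-1,k-1)+\tilde C(n-1,k)$. *)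

theory Defs
  imports Complex_Main "HOL-Library.Poly_Mapping"
begin

text \<open>
  \<^term>\<open>LH i\<close> is the letter for the generator \<open>H\<close> of index \<open>i + 1\<close> (there is no generator
  of index 0), \<^term>\<open>LHt i\<close> the letter for the generator \<open>H~\<close> of index \<open>i\<close>.
\<close>
datatype letter = LH nat | LHt nat

text \<open>Words form a monoid under concatenation, written additively as
  \<^typ>\<open>'a \<Rightarrow>\<^sub>0 'b\<close> requires; the monoid algebra of words over \<^typ>\<open>rat\<close> is the free
  associative unital algebra on the letters.\<close>
instantiation list :: (type) monoid_add
begin
definition zero_list :: "'a list" where "0 = []"
definition plus_list :: "'a list \<Rightarrow> 'a list \<Rightarrow> 'a list" where "xs + ys = xs @ ys"
instance by standard (simp_all add: zero_list_def plus_list_def)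
end

type_synonym snsym = "letter list \<Rightarrow>\<^sub>0 rat"

definition H :: "nat \<Rightarrow> snsym" where
  "H n = (case n of 0 \<Rightarrow> 1 | Suc i \<Rightarrow> Poly_Mapping.single [LH i] 1)"

definition Ht :: "nat \<Rightarrow> snsym" where
  "Ht n = Poly_Mapping.single [LHt n] 1"

fun letter_df :: "letter \<Rightarrow> nat" where
  "letter_df (LH _) = 0"
| "letter_df (LHt _) = 1"

definition df :: "letter list \<Rightarrow> nat" where
  "df w = sum_list (map letter_df w)"

definition homogeneous :: "nat \<Rightarrow> snsym \<Rightarrow> bool" where
  "homogeneous d f \<longleftrightarrow> (\<forall>w\<in>Poly_Mapping.keys f. df w = d)"

definition pscale :: "rat \<Rightarrow> ('a \<Rightarrow>\<^sub>0 rat) \<Rightarrow> ('a \<Rightarrow>\<^sub>0 rat)" where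
  "pscale c f = Poly_Mapping.map ((*) c) f"

lemma lookup_pscale [simp]: "Poly_Mapping.lookup (pscale c f) x = c * Poly_Mapping.lookup f x"
  by (simp add: pscale_def map.rep_eq when_def)

lemma vector_space_pscale: "vector_space pscale"
  by standard (rule poly_mapping_eqI; simp add: lookup_add algebra_simps)+

lemma pscale_single [simp]: "pscale c (Poly_Mapping.single x a) = Poly_Mapping.single x (c * a)"
  by (rule poly_mapping_eqI) (simp add: lookup_single when_def)

lemma pscale_mult:
  fixes f g :: "'a::monoid_add \<Rightarrow>\<^sub>0 rat"
  shows "pscale c f * g = pscale c (f * g)" "f * pscale c g = pscale c (f * g)"
proof -
  have l: "pscale c h = Poly_Mapping.single 0 c * h" for h :: "'a \<Rightarrow>\<^sub>0 rat"
    by (simp add: pscale_def mult_map_scale_conv_mult)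
  have r: "Poly_Mapping.single 0 c * h = h * Poly_Mapping.single 0 c" for h :: "'a \<Rightarrow>\<^sub>0 rat"
  proof (induction h rule: update_induct)
    case const then show ?case by simp
  next
    case (update h a b)
    have "Poly_Mapping.update a b h = h + Poly_Mapping.single a b"
      using update by (intro poly_mapping_eqI)
        (auto simp: lookup_update lookup_add lookup_single when_def in_keys_iff)
    with update show ?case by (simp add: algebra_simps mult_single)
  qed
  show "pscale c f * g = pscale c (f * g)" by (simp add: l mult.assoc)
  show "f * pscale c g = pscale c (f * g)" by (metis l r mult.assoc)
qed

lemma poly_mapping_linear_induct [case_names zero single add]:
  fixes f :: "'a \<Rightarrow>\<^sub>0 'b::comm_monoid_add"
  assumes "P 0" "\<And>x a. P (Poly_Mapping.single x a)" "\<And>f g. P f \<Longrightarrow> P g \<Longrightarrow> P (f + g)"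
  shows "P f"
proof (induction f rule: update_induct)
  case const then show ?case using assms(1) by simp
next
  case (update h a b)
  have "Poly_Mapping.update a b h = h + Poly_Mapping.single a b"
    using update by (intro poly_mapping_eqI)
      (auto simp: lookup_update lookup_add lookup_single when_def in_keys_iff)
  with update show ?case using assms by simp
qed

lemma sum_keys_add:
  fixes h :: "'a \<Rightarrow> 'b::comm_monoid_add \<Rightarrow> 'c::comm_monoid_add"
  assumes z: "\<And>x. h x 0 = 0" and a: "\<And>x a b. h x (a + b) = h x a + h x b"
  shows "(\<Sum>x\<in>Poly_Mapping.keys (f + g). h x (Poly_Mapping.lookup (f + g) x)) =
    (\<Sum>x\<in>Poly_Mapping.keys f. h x (Poly_Mapping.lookup f x)) +
    (\<Sum>x\<in>Poly_Mapping.keys g. h x (Poly_Mapping.lookup g x))"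
proof -
  let ?K = "Poly_Mapping.keys f \<union> Poly_Mapping.keys g"
  have e: "(\<Sum>x\<in>Poly_Mapping.keys p. h x (Poly_Mapping.lookup p x)) =
    (\<Sum>x\<in>?K. h x (Poly_Mapping.lookup p x))" if "Poly_Mapping.keys p \<subseteq> ?K" for p
    using that by (intro sum.mono_neutral_left) (auto simp: in_keys_iff z)
  show ?thesis
    unfolding e[OF keys_add] e[OF Un_upper1] e[OF Un_upper2]
    by (simp add: lookup_add a sum.distrib)
qed

text \<open>
  Words form a basis of \<^typ>\<open>snsym\<close>, so pairs of words form a basis of its tensor square. The
  square is a separate type because its multiplication carries signs.
\<close>
typedef snsym2 = "UNIV :: ((letter list \<times> letter list) \<Rightarrow>\<^sub>0 rat) set"
  morphisms coords of_coords ..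

setup_lifting type_definition_snsym2

definition signed_mult :: "((letter list \<times> letter list) \<Rightarrow>\<^sub>0 rat) \<Rightarrow>
    ((letter list \<times> letter list) \<Rightarrow>\<^sub>0 rat) \<Rightarrow> ((letter list \<times> letter list) \<Rightarrow>\<^sub>0 rat)" where
  "signed_mult P Q =
    (\<Sum>(u, v)\<in>Poly_Mapping.keys P. \<Sum>(u', v')\<in>Poly_Mapping.keys Q.
      Poly_Mapping.single (u @ u', v @ v')
        ((-1) ^ (df v * df u') * Poly_Mapping.lookup P (u, v) * Poly_Mapping.lookup Q (u', v')))"

lemma signed_mult_add_left: "signed_mult (P + P') Q = signed_mult P Q + signed_mult P' Q"
proof -
  define h where "h = (\<lambda>p a. \<Sum>(u', v')\<in>Poly_Mapping.keys Q.
    Poly_Mapping.single (fst p @ u', snd p @ v')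
      ((-1) ^ (df (snd p) * df u') * a * Poly_Mapping.lookup Q (u', v')))"
  have "signed_mult P Q = (\<Sum>p\<in>Poly_Mapping.keys P. h p (Poly_Mapping.lookup P p))" for P
    by (simp add: signed_mult_def h_def case_prod_beta)
  moreover have "h p 0 = 0" "h p (a + b) = h p a + h p b" for p a b
    by (simp_all add: h_def case_prod_beta algebra_simps single_add sum.distrib)
  ultimately show ?thesis by (simp add: sum_keys_add)
qed

lemma signed_mult_add_right: "signed_mult P (Q + Q') = signed_mult P Q + signed_mult P Q'"
proof -
  define h where "h = (\<lambda>q b. \<Sum>(u, v)\<in>Poly_Mapping.keys P.
    Poly_Mapping.single (u @ fst q, v @ snd q)
      ((-1) ^ (df v * df (fst q)) * Poly_Mapping.lookup P (u, v) * b))"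
  have "signed_mult P Q = (\<Sum>q\<in>Poly_Mapping.keys Q. h q (Poly_Mapping.lookup Q q))" for Q
    by (simp add: signed_mult_def h_def case_prod_beta)
      (rule sum.swap)
  moreover have "h q 0 = 0" "h q (a + b) = h q a + h q b" for q a b
    by (simp_all add: h_def case_prod_beta algebra_simps single_add sum.distrib)
  ultimately show ?thesis by (simp add: sum_keys_add)
qed

lemma signed_mult_zero [simp]: "signed_mult 0 Q = 0" "signed_mult P 0 = 0"
  by (simp_all add: signed_mult_def)

lemma signed_mult_single:
  "signed_mult (Poly_Mapping.single (u, v) a) (Poly_Mapping.single (u', v') b) =
    Poly_Mapping.single (u @ u', v @ v') ((-1) ^ (df v * df u') * a * b)"
  by (simp add: signed_mult_def)

lemma df_simps [simp]: "df [] = 0" "df (u @ v) = df u + df v" "df (x # v) = letter_df x + df v"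
  by (simp_all add: df_def)

lemma signed_mult_assoc: "signed_mult (signed_mult P Q) R = signed_mult P (signed_mult Q R)"
proof (induction P rule: poly_mapping_linear_induct)
  case P: (single p a)
  show ?case
  proof (induction Q rule: poly_mapping_linear_induct)
    case Q: (single q b)
    show ?case
    proof (induction R rule: poly_mapping_linear_induct)
      case R: (single r c)
      obtain u v u' v' u'' v'' where "p = (u, v)" "q = (u', v')" "r = (u'', v'')"
        by (metis surj_pair)
      then show ?case by (simp add: signed_mult_single algebra_simps power_add)
    qed (simp_all add: signed_mult_add_right)
  qed (simp_all add: signed_mult_add_left signed_mult_add_right)
qed (simp_all add: signed_mult_add_left)

lemma signed_mult_one:
  "signed_mult (Poly_Mapping.single ([], []) 1) P = P"
  "signed_mult P (Poly_Mapping.single ([], []) 1) = P"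
proof -
  show "signed_mult (Poly_Mapping.single ([], []) 1) P = P"
    by (induction P rule: poly_mapping_linear_induct)
      (auto simp: signed_mult_add_right signed_mult_single)
  show "signed_mult P (Poly_Mapping.single ([], []) 1) = P"
    by (induction P rule: poly_mapping_linear_induct)
      (auto simp: signed_mult_add_left signed_mult_single)
qed

instantiation snsym2 :: ring_1
begin
lift_definition zero_snsym2 :: snsym2 is 0 .
lift_definition one_snsym2 :: snsym2 is "Poly_Mapping.single ([], []) 1" .
lift_definition plus_snsym2 :: "snsym2 \<Rightarrow> snsym2 \<Rightarrow> snsym2" is "(+)" .
lift_definition minus_snsym2 :: "snsym2 \<Rightarrow> snsym2 \<Rightarrow> snsym2" is "(-)" .
lift_definition uminus_snsym2 :: "snsym2 \<Rightarrow> snsym2" is uminus .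
lift_definition times_snsym2 :: "snsym2 \<Rightarrow> snsym2 \<Rightarrow> snsym2" is signed_mult .
instance
  by standard (transfer, auto simp: signed_mult_assoc signed_mult_one signed_mult_add_left
      signed_mult_add_right algebra_simps dest: arg_cong[where f = "\<lambda>f. Poly_Mapping.lookup f ([], [])"])+
end

lift_definition scale2 :: "rat \<Rightarrow> snsym2 \<Rightarrow> snsym2" (infixr \<open>*\<^sub>Q\<close> 75) is pscale .

lemma vector_space_scale2: "vector_space scale2"
proof -
  interpret p: vector_space "pscale :: rat \<Rightarrow> ((letter list \<times> letter list) \<Rightarrow>\<^sub>0 rat) \<Rightarrow> _"
    by (rule vector_space_pscale)
  show ?thesis
    by standard (simp_all add: coords_inject[symmetric] scale2.rep_eq plus_snsym2.rep_eq
        p.scale_left_distrib p.scale_right_distrib)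
qed

definition tensor_coords :: "snsym \<Rightarrow> snsym \<Rightarrow> ((letter list \<times> letter list) \<Rightarrow>\<^sub>0 rat)" where
  "tensor_coords f g = (\<Sum>u\<in>Poly_Mapping.keys f. \<Sum>v\<in>Poly_Mapping.keys g.
    Poly_Mapping.single (u, v) (Poly_Mapping.lookup f u * Poly_Mapping.lookup g v))"

lift_definition tensor :: "snsym \<Rightarrow> snsym \<Rightarrow> snsym2" (infix \<open>\<otimes>\<close> 78) is tensor_coords .

lemma lookup_tensor_coords:
  "Poly_Mapping.lookup (tensor_coords f g) (u, v) = Poly_Mapping.lookup f u * Poly_Mapping.lookup g v"
proof -
  have "Poly_Mapping.lookup (tensor_coords f g) (u, v) =
    (\<Sum>(x, y)\<in>Poly_Mapping.keys f \<times> Poly_Mapping.keys g.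
      if (x, y) = (u, v) then Poly_Mapping.lookup f x * Poly_Mapping.lookup g y else 0)"
    unfolding sum.cartesian_product[symmetric]
    by (simp add: tensor_coords_def lookup_sum lookup_single when_def)
  also have "\<dots> = (\<Sum>p\<in>Poly_Mapping.keys f \<times> Poly_Mapping.keys g.
      if p = (u, v) then Poly_Mapping.lookup f u * Poly_Mapping.lookup g v else 0)"
    by (intro sum.cong) (auto split: if_splits)
  also have "\<dots> = Poly_Mapping.lookup f u * Poly_Mapping.lookup g v"
    by (subst sum.delta) (auto simp: in_keys_iff)
  finally show ?thesis .
qed

lemma tensor_bilinear:
  "(f + f') \<otimes> g = f \<otimes> g + f' \<otimes> g" "f \<otimes> (g + g') = f \<otimes> g + f \<otimes> g'"
  "pscale c f \<otimes> g = c *\<^sub>Q (f \<otimes> g)" "f \<otimes> pscale c g = c *\<^sub>Q (f \<otimes> g)"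
  by (simp_all add: coords_inject[symmetric] poly_mapping_eq_iff fun_eq_iff tensor.rep_eq
      plus_snsym2.rep_eq scale2.rep_eq lookup_tensor_coords lookup_add algebra_simps)

lemma tensor_one: "1 \<otimes> 1 = 1"
  by (auto simp: coords_inject[symmetric] poly_mapping_eq_iff fun_eq_iff tensor.rep_eq
      one_snsym2.rep_eq lookup_tensor_coords lookup_one lookup_single when_def zero_list_def)

lemma tensor_zero [simp]: "0 \<otimes> g = 0" "f \<otimes> 0 = 0"
  by (simp_all add: coords_inject[symmetric] tensor.rep_eq zero_snsym2.rep_eq tensor_coords_def)

lemma tensor_single:
  "coords (Poly_Mapping.single u a \<otimes> Poly_Mapping.single v b) = Poly_Mapping.single (u, v) (a * b)"
  by (simp add: tensor.rep_eq tensor_coords_def)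

text \<open>
  \<^const>\<open>signed_mult\<close> is the bilinear extension of the sign rule on the basis; the
  rule then holds for all homogeneous elements.
\<close>
lemma tensor_mult_homogeneous:
  assumes "homogeneous d g" "homogeneous e f'"
  shows "(f \<otimes> g) * (f' \<otimes> g') = (-1) ^ (d * e) *\<^sub>Q ((f * f') \<otimes> (g * g'))"
proof -
  have expand: "p = (\<Sum>w\<in>Poly_Mapping.keys p. Poly_Mapping.single w (Poly_Mapping.lookup p w))" for p :: snsym
    by (rule poly_mapping_eqI) (simp add: lookup_sum lookup_single when_def in_keys_iff)
  have sum_l: "(\<Sum>i\<in>I. F i) \<otimes> q = (\<Sum>i\<in>I. F i \<otimes> q)" for I and F :: "letter list \<Rightarrow> snsym" and q
    by (induction I rule: infinite_finite_induct) (simp_all add: tensor_bilinear)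
  have sum_r: "q \<otimes> (\<Sum>i\<in>I. F i) = (\<Sum>i\<in>I. q \<otimes> F i)" for I and F :: "letter list \<Rightarrow> snsym" and q
    by (induction I rule: infinite_finite_induct) (simp_all add: tensor_bilinear)
  interpret vector_space scale2 by (rule vector_space_scale2)
  have base: "(Poly_Mapping.single u a \<otimes> Poly_Mapping.single v b) *
      (Poly_Mapping.single u' a' \<otimes> Poly_Mapping.single v' b') =
    (-1) ^ (df v * df u') *\<^sub>Q ((Poly_Mapping.single u a * Poly_Mapping.single u' a') \<otimes>
      (Poly_Mapping.single v b * Poly_Mapping.single v' b'))" for u v u' v' a b a' b'
    by (simp add: coords_inject[symmetric] times_snsym2.rep_eq scale2.rep_eq tensor_single
        signed_mult_single mult_single plus_list_def algebra_simps)
  have step1: "(f \<otimes> Poly_Mapping.single v b) * (Poly_Mapping.single u' a' \<otimes> g') =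
    (-1) ^ (df v * df u') *\<^sub>Q ((f * Poly_Mapping.single u' a') \<otimes> (Poly_Mapping.single v b * g'))"
    for v b u' a'
  proof (induction f rule: poly_mapping_linear_induct)
    case (single u a)
    show ?case
      by (induction g' rule: poly_mapping_linear_induct)
        (simp_all add: base tensor_bilinear distrib_left distrib_right scale_right_distrib)
  qed (simp_all add: tensor_bilinear distrib_left distrib_right scale_right_distrib)
  have "(f \<otimes> g) * (f' \<otimes> g') = (\<Sum>v\<in>Poly_Mapping.keys g. \<Sum>u'\<in>Poly_Mapping.keys f'.
      (f \<otimes> Poly_Mapping.single v (Poly_Mapping.lookup g v)) *
      (Poly_Mapping.single u' (Poly_Mapping.lookup f' u') \<otimes> g'))"
    by (subst (1) expand[of g], subst (1) expand[of f'])
      (simp only: sum_l sum_r sum_product)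
  also have "\<dots> = (\<Sum>v\<in>Poly_Mapping.keys g. \<Sum>u'\<in>Poly_Mapping.keys f'. (-1) ^ (d * e) *\<^sub>Q
      ((f * Poly_Mapping.single u' (Poly_Mapping.lookup f' u')) \<otimes>
       (Poly_Mapping.single v (Poly_Mapping.lookup g v) * g')))"
    using assms by (intro sum.cong refl) (simp add: step1 homogeneous_def)
  also have "\<dots> = (-1) ^ (d * e) *\<^sub>Q ((f * f') \<otimes> (g * g'))"
  proof -
    have "(f * f') \<otimes> (g * g') =
      (f * (\<Sum>u'\<in>Poly_Mapping.keys f'. Poly_Mapping.single u' (Poly_Mapping.lookup f' u'))) \<otimes>
      ((\<Sum>v\<in>Poly_Mapping.keys g. Poly_Mapping.single v (Poly_Mapping.lookup g v)) * g')"
      by (simp only: expand[symmetric])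
    also have "\<dots> = (\<Sum>v\<in>Poly_Mapping.keys g. \<Sum>u'\<in>Poly_Mapping.keys f'.
      (f * Poly_Mapping.single u' (Poly_Mapping.lookup f' u')) \<otimes>
      (Poly_Mapping.single v (Poly_Mapping.lookup g v) * g'))"
      by (simp only: sum_distrib_left sum_distrib_right sum_l sum_r)
    finally show ?thesis by (simp only: scale_sum_right)
  qed
  finally show ?thesis .
qed

fun coproduct_letter :: "letter \<Rightarrow> snsym2" where
  "coproduct_letter (LH i) = (\<Sum>k=0..Suc i. H k \<otimes> H (Suc i - k))"
| "coproduct_letter (LHt n) = (\<Sum>k=0..n. Ht k \<otimes> H (n - k) + H (n - k) \<otimes> Ht k)"

definition coproduct :: "snsym \<Rightarrow> snsym2" (\<open>\<Delta>\<close>) where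
  "\<Delta> f = (\<Sum>w\<in>Poly_Mapping.keys f. Poly_Mapping.lookup f w *\<^sub>Q prod_list (map coproduct_letter w))"

lemma scale2_mult: "(c *\<^sub>Q x) * y = c *\<^sub>Q (x * y)" "x * (c *\<^sub>Q y) = c *\<^sub>Q (x * y)"
proof -
  interpret p: vector_space "pscale :: rat \<Rightarrow> ((letter list \<times> letter list) \<Rightarrow>\<^sub>0 rat) \<Rightarrow> _"
    by (rule vector_space_pscale)
  have "signed_mult (pscale c P) Q = pscale c (signed_mult P Q) \<and>
    signed_mult P (pscale c Q) = pscale c (signed_mult P Q)" for P Q
  proof (induction P rule: poly_mapping_linear_induct)
    case (single p a)
    show ?case
    proof (induction Q rule: poly_mapping_linear_induct)
      case (single q b)
      then show ?case by (cases p; cases q) (simp add: signed_mult_single algebra_simps)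
    qed (simp_all add: signed_mult_add_right p.scale_right_distrib del: pscale_single)
  qed (simp_all add: signed_mult_add_left p.scale_right_distrib)
  then show "(c *\<^sub>Q x) * y = c *\<^sub>Q (x * y)" "x * (c *\<^sub>Q y) = c *\<^sub>Q (x * y)"
    by (simp_all add: coords_inject[symmetric] scale2.rep_eq times_snsym2.rep_eq)
qed

text \<open>
  \<^term>\<open>\<Delta>\<close> is defined by multiplicative extension to words and linear extension from there;
  the following facts show that it is the algebra morphism determined by its values
  on the generators.
\<close>

lemma coproduct_add: "\<Delta> (f + g) = \<Delta> f + \<Delta> g"
proof -
  interpret vector_space scale2 by (rule vector_space_scale2)
  show ?thesis unfolding coproduct_def
    by (rule sum_keys_add) (simp_all add: scale_left_distrib)
qed

lemma coproduct_single:
  "\<Delta> (Poly_Mapping.single w a) = a *\<^sub>Q prod_list (map coproduct_letter w)"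
proof -
  interpret vector_space scale2 by (rule vector_space_scale2)
  show ?thesis by (simp add: coproduct_def)
qed

lemma coproduct_zero [simp]: "\<Delta> 0 = 0"
  by (simp add: coproduct_def)

lemma coproduct_scale: "\<Delta> (pscale c f) = c *\<^sub>Q \<Delta> f"
proof -
  interpret vector_space scale2 by (rule vector_space_scale2)
  interpret p: vector_space "pscale :: rat \<Rightarrow> snsym \<Rightarrow> snsym" by (rule vector_space_pscale)
  show ?thesis
    by (induction f rule: poly_mapping_linear_induct)
      (simp_all add: coproduct_add coproduct_single scale_right_distrib p.scale_right_distrib)
qed

lemma coproduct_one: "\<Delta> 1 = 1"
proof -
  interpret vector_space scale2 by (rule vector_space_scale2)
  show ?thesis
    using coproduct_single[of "[]" 1] single_one[where 'a = "letter list" and 'b = rat]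
    by (simp add: zero_list_def)
qed

lemma coproduct_mult: "\<Delta> (f * g) = \<Delta> f * \<Delta> g"
proof -
  interpret vector_space scale2 by (rule vector_space_scale2)
  show ?thesis
  proof (induction f rule: poly_mapping_linear_induct)
    case (single u a)
    show ?case
      by (induction g rule: poly_mapping_linear_induct)
        (simp_all add: distrib_left coproduct_add coproduct_single mult_single scale2_mult
          plus_list_def)
  qed (simp_all add: distrib_right coproduct_add)
qed

lemma coproduct_H: "\<Delta> (H n) = (\<Sum>k=0..n. H k \<otimes> H (n - k))"
proof -
  interpret vector_space scale2 by (rule vector_space_scale2)
  show ?thesis
    by (cases n) (simp_all add: H_def[of 0] H_def[of "Suc _"] coproduct_one coproduct_single tensor_one)
qed

lemma coproduct_Ht: "\<Delta> (Ht n) = (\<Sum>k=0..n. Ht k \<otimes> H (n - k) + H (n - k) \<otimes> Ht k)"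
proof -
  interpret vector_space scale2 by (rule vector_space_scale2)
  show ?thesis by (simp add: Ht_def[of n] coproduct_single)
qed

text \<open>Only the values with \<open>k \<le> n\<close> matter; the others are set to 0.\<close>
function Ctilde :: "nat \<Rightarrow> nat \<Rightarrow> nat" where
  "Ctilde n k =
    (if k > n then 0
     else if k = 0 \<or> k = n then 1
     else if even n \<and> odd k then 0
     else Ctilde (n - 1) (k - 1) + Ctilde (n - 1) k)"
  by pat_completeness auto
termination by (relation "measure fst") auto

declare Ctilde.simps [simp del]

end

theory Submission
  imports Defs
begin

text \<open>
  Write \<open>x = Ht 0\<close>. Since \<open>H 0 = 1\<close>, the coproduct of \<open>x\<close> is \<open>A + B\<close> with
  \<open>A = x \<otimes> 1\<close> and \<open>B = 1 \<otimes> x\<close>, and because \<open>x\<close> is odd the sign rule gives \<open>B A = - A B\<close>, while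
  \<open>x^a \<otimes> x^b = A^a B^b\<close>. So the coproduct of \<open>x^n\<close> is \<open>(A + B)^n\<close>, and the theorem is the
  \<open>q\<close>-binomial theorem at \<open>q = -1\<close>.

  Multiplying by \<open>A + B\<close> on the right shows that the coefficients \<open>c n k\<close> of \<open>A^(n-k) B^k\<close> satisfy
  the signed Pascal rule \<open>c (n+1) (k+1) = (-1)^(k+1) * c n (k+1) + c n k\<close>, where the sign comes from
  moving \<open>A\<close> past \<open>B^(k+1)\<close>. The numbers \<open>Ctilde n k\<close>, defined by an unsigned rule with forced zeros,
  obey the same signed rule (\<open>Ctilde_signed_Pascal\<close>): for even \<open>k+1\<close> the
  two rules are the same; for odd \<open>k+1\<close>, either \<open>n\<close> is
  even and the summand with the sign vanishes, or \<open>n\<close> is odd and both summands are equal, so they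
  cancel to the forced zero.
\<close>

lemma Ctilde_0_right [simp]: "Ctilde n 0 = 1"
  by (subst Ctilde.simps) simp

lemma Ctilde_eq_0 [simp]: "n < k \<Longrightarrow> Ctilde n k = 0"
  by (subst Ctilde.simps) simp

lemma Ctilde_self [simp]: "Ctilde n n = 1"
  by (subst Ctilde.simps) simp

lemma Ctilde_even_odd: "even n \<Longrightarrow> odd k \<Longrightarrow> Ctilde n k = 0"
  by (subst Ctilde.simps) (auto dest: odd_pos)

text \<open>
  Outside the forced zeros the Pascal rule needs no case distinction on the boundary: at \<open>k = n\<close>
  it reads \<open>1 = 1 + 0\<close>, and for \<open>k > n\<close> all terms vanish.
\<close>
lemma Ctilde_Suc_Suc:
  "even n \<or> odd k \<Longrightarrow> Ctilde (Suc n) (Suc k) = Ctilde n k + Ctilde n (Suc k)"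
  by (cases n k rule: linorder_cases; subst Ctilde.simps) auto

text \<open>
  Both entries equal \<open>Ctilde (n - 1) k\<close>, their common neighbour in the row above: the other neighbour
  of each lies in an odd column of that even row, so it vanishes (and there is none for \<open>k = 0\<close>).
\<close>
lemma Ctilde_odd_pair:
  assumes "odd n" "even k"
  shows "Ctilde n (Suc k) = Ctilde n k"
proof -
  obtain m where m: "n = Suc m" "even m"
    using assms(1) by (cases n) auto
  have "Ctilde n (Suc k) = Ctilde m k"
    using m assms(2) by (simp add: Ctilde_Suc_Suc Ctilde_even_odd)
  also have "\<dots> = Ctilde n k"
    using m assms(2) by (cases k) (simp_all add: Ctilde_Suc_Suc Ctilde_even_odd)
  finally show ?thesis .
qed

lemma Ctilde_signed_Pascal:
  "(of_nat (Ctilde (Suc n) (Suc k)) :: 'a::ring_1) =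
    (-1) ^ Suc k * of_nat (Ctilde n (Suc k)) + of_nat (Ctilde n k)"
proof (cases "odd k")
  case True
  then show ?thesis by (simp add: Ctilde_Suc_Suc)
next
  case False
  then show ?thesis
  proof (cases "even n")
    case True
    with False show ?thesis by (simp add: Ctilde_Suc_Suc Ctilde_even_odd)
  next
    case odd: False
    with False show ?thesis by (simp add: Ctilde_even_odd Ctilde_odd_pair)
  qed
qed

lemma coproduct_Ht_0: "\<Delta> (Ht 0) = Ht 0 \<otimes> 1 + 1 \<otimes> Ht 0"
  by (simp add: coproduct_Ht H_def)

lemma Ht_power: "Ht i ^ m = Poly_Mapping.single (replicate m (LHt i)) 1"
proof (induction m)
  case 0
  show ?case by (metis power_0 replicate_0 single_one zero_list_def)
next
  case (Suc m)
  then show ?case by (simp add: Ht_def mult_single plus_list_def)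
qed

lemma homogeneous_Ht_power: "homogeneous m (Ht i ^ m)"
  by (simp add: homogeneous_def Ht_power df_def sum_list_replicate)

text \<open>
  Multiplying on the right makes the sign depend on \<open>b\<close> alone, the index \<open>k\<close> of the binomial sum;
  multiplying on the left would put a sign \<open>(-1)^a\<close> on the other factor instead.
\<close>
lemma tensor_Ht_powers_mult:
  "(Ht i ^ a \<otimes> Ht i ^ b) * (Ht i \<otimes> 1) = (-1) ^ b *\<^sub>Q (Ht i ^ Suc a \<otimes> Ht i ^ b)"
  "(Ht i ^ a \<otimes> Ht i ^ b) * (1 \<otimes> Ht i) = Ht i ^ a \<otimes> Ht i ^ Suc b"
proof -
  interpret vector_space scale2 by (rule vector_space_scale2)
  show "(Ht i ^ a \<otimes> Ht i ^ b) * (Ht i \<otimes> 1) = (-1) ^ b *\<^sub>Q (Ht i ^ Suc a \<otimes> Ht i ^ b)"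
    using tensor_mult_homogeneous[OF homogeneous_Ht_power[of b i] homogeneous_Ht_power[of 1 i],
        of "Ht i ^ a" 1]
    by (simp add: power_commutes)
  show "(Ht i ^ a \<otimes> Ht i ^ b) * (1 \<otimes> Ht i) = Ht i ^ a \<otimes> Ht i ^ Suc b"
    using tensor_mult_homogeneous[OF homogeneous_Ht_power[of b i] homogeneous_Ht_power[of 0 i],
        of "Ht i ^ a" "Ht i"]
    by (simp add: power_commutes)
qed

theorem proposition4p3:
  fixes n :: nat
  shows "\<Delta> (Ht 0 ^ n) =
    (\<Sum>k=0..n. of_nat (Ctilde n k) *\<^sub>Q ((Ht 0 ^ (n - k)) \<otimes> (Ht 0 ^ k)))"
proof (induction n)
  interpret vector_space scale2 by (rule vector_space_scale2)
  case 0
  show ?case by (simp add: coproduct_one tensor_one)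
next
  interpret vector_space scale2 by (rule vector_space_scale2)
  case (Suc n)
  let ?T = "\<lambda>k. Ht 0 ^ (Suc n - k) \<otimes> Ht 0 ^ k"
  let ?c = "\<lambda>n k. of_nat (Ctilde n k) :: rat"
  have "\<Delta> (Ht 0 ^ Suc n) = \<Delta> (Ht 0 ^ n) * (Ht 0 \<otimes> 1 + 1 \<otimes> Ht 0)"
    by (simp only: power_Suc2 coproduct_mult coproduct_Ht_0)
  also have "\<dots> = (\<Sum>k=0..n. (?c n k * (-1) ^ k) *\<^sub>Q ?T k + ?c n k *\<^sub>Q ?T (Suc k))"
    unfolding Suc sum_distrib_right
    by (intro sum.cong refl)
      (simp add: distrib_left scale2_mult tensor_Ht_powers_mult Suc_diff_le del: power_Suc)
  also have "\<dots> = (\<Sum>k=0..Suc n. (?c n k * (-1) ^ k) *\<^sub>Q ?T k) + (\<Sum>k=0..n. ?c n k *\<^sub>Q ?T (Suc k))"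
    \<comment> \<open>The added term \<open>k = Suc n\<close> vanishes; it makes room for splitting off \<open>k = 0\<close> next.\<close>
    by (simp add: sum.distrib)
  also have "\<dots> = ?T 0 + (\<Sum>k=0..n. (?c n (Suc k) * (-1) ^ Suc k) *\<^sub>Q ?T (Suc k) + ?c n k *\<^sub>Q ?T (Suc k))"
    unfolding sum.atLeast0_atMost_Suc_shift by (simp add: sum.distrib del: power_Suc)
  also have "\<dots> = ?T 0 + (\<Sum>k=0..n. ?c (Suc n) (Suc k) *\<^sub>Q ?T (Suc k))"
    by (simp only: scale_left_distrib[symmetric] Ctilde_signed_Pascal mult.commute)
  also have "\<dots> = (\<Sum>k=0..Suc n. ?c (Suc n) k *\<^sub>Q ?T k)"
    unfolding sum.atLeast0_atMost_Suc_shift by simp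
  finally show ?case .
qed

end
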